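(* Let $0<\alpha<\pi/2$. Let $f\in C^\infty(\mathbb T)$ with $\operatorname{supp} f\subseteq D_\alpha$ and set $$F(m,n)=\frac{1}{2\pi}\int_{\mathbb T} f(t)\, e_t(m,n)\, dt,\qquad (m,n)\in\mathbb Z^2.$$ Then $F$ is a discrete entire function with the property that for every $k\in\mathbb N$ and every $\varepsilon>0$ with $\alpha+\varepsilon<\pi/2$ there exists a constant $c_{k,\varepsilon,\alpha}>0$ such that, for every $(m,n)\in\mathbb Z^2$, $$|F(m,n)|\leqslant c_{k,\varepsilon,\alpha}\,(1+|m|)^{-k}\,|e_{-(\alpha+\varepsilon)}(0,1)|^{|n|}.$$
   Context: The torus $\mathbb T=\mathbb R/2\pi\mathbb Z$ is identified with $[-\pi,\pi)$. A function $F:\mathbb Z^2\to\mathbb C$ is discrete entire if $F(m+1,n+1)-F(m,n)=-i\big(F(m,n+1)-F(m+1,n)\big)$ for every $(m,n)\in\mathbb Z^2$. For $t\in\mathbb T$, $t\neq\pm\pi/2$, the discrete exponential is $e_t:\mathbb Z^2\to\mathbb C$, $e_t(m,n)=e^{itm}\Big(\frac{1+ie^{it}}{i+e^{it}}\Big)^n$. For $0<\alpha<\pi/2$, $D_\alpha=\{t\in\mathbb T: |t|\leqslant\alpha\}\cup\{t\in\mathbb T:\pi-\alpha\leqslant|t|\leqslant\pi\}$. *)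

theory Defs
  imports "HOL-Analysis.Analysis"
begin

text \<open>Functions on the torus \<open>\<T> = \<real>/2\<pi>\<int>\<close> are represented by their \<open>2\<pi>\<close>-periodic lifts
  to \<open>\<real>\<close>, and subsets of \<open>\<T>\<close> by subsets of \<open>[-\<pi>, \<pi>)\<close>.\<close>

definition smooth :: "(real \<Rightarrow> complex) \<Rightarrow> bool" where
  "smooth f \<longleftrightarrow>
     (\<forall>k t. ((\<lambda>g s. vector_derivative g (at s)) ^^ k) f differentiable (at t))"

definition smooth_torus :: "(real \<Rightarrow> complex) \<Rightarrow> bool" where
  "smooth_torus f \<longleftrightarrow> (\<forall>t. f (t + 2 * pi) = f t) \<and> smooth f"

text \<open>The preimage in \<open>\<real>\<close> of a subset of \<open>\<T>\<close>.\<close>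

definition torus_preimage :: "real set \<Rightarrow> real set" where
  "torus_preimage A = {t + 2 * pi * real_of_int j | t j. t \<in> A}"

text \<open>The support of the periodic lift; it is the preimage of the support in \<open>\<T>\<close>, because
  the covering map \<open>\<real> \<rightarrow> \<T>\<close> is continuous and open.\<close>

definition lift_supp :: "(real \<Rightarrow> complex) \<Rightarrow> real set" where
  "lift_supp f = closure {t. f t \<noteq> 0}"

definition D_set :: "real \<Rightarrow> real set" where
  "D_set \<alpha> = {t \<in> {-pi..<pi}. \<bar>t\<bar> \<le> \<alpha>} \<union> {t \<in> {-pi..<pi}. pi - \<alpha> \<le> \<bar>t\<bar> \<and> \<bar>t\<bar> \<le> pi}"

definition discrete_entire :: "(int \<Rightarrow> int \<Rightarrow> complex) \<Rightarrow> bool" where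
  "discrete_entire F \<longleftrightarrow>
     (\<forall>m n. F (m + 1) (n + 1) - F m n = - \<i> * (F m (n + 1) - F (m + 1) n))"

text \<open>Meaningful only for \<open>t \<noteq> \<plusminus>\<pi>/2\<close> modulo \<open>2\<pi>\<close>; at these points the value is an artefact of
  division by zero.\<close>

definition disc_exp :: "real \<Rightarrow> int \<Rightarrow> int \<Rightarrow> complex" where
  "disc_exp t m n =
     exp (\<i> * of_real t * of_int m) *
     ((1 + \<i> * exp (\<i> * of_real t)) / (\<i> + exp (\<i> * of_real t))) powi n"

definition exp_transform :: "(real \<Rightarrow> complex) \<Rightarrow> int \<Rightarrow> int \<Rightarrow> complex" where
  "exp_transform f m n =
     1 / (2 * of_real pi) * integral {-pi..pi} (\<lambda>t. f t * disc_exp t m n)"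

end

theory Submission
  imports Defs
begin

text \<open>The factor by which \<open>e\<^sub>t(m, n)\<close> grows when \<open>n\<close> increases by one is the real number
\<open>E(t) = cos t / (1 + sin t)\<close>, and \<open>E(t)\<^sup>2 = (1 - sin t) / (1 + sin t)\<close>. If \<open>t\<close> lies over \<open>D\<^sub>\<alpha>\<close>, then
\<open>\<bar>sin t\<bar> \<le> sin \<alpha>\<close>, so that both \<open>\<bar>E(t)\<bar>\<close> and its inverse are at most
\<open>R\<^sub>\<alpha> = \<bar>e\<^bsub>-\<alpha>\<^esub>(0, 1)\<bar>\<close>, which is strictly increasing in \<open>\<alpha>\<close>. This gives the growth in \<open>n\<close>
(\<open>norm_coeff_le\<close>).

The decay in \<open>m\<close> comes from integration by parts over the circle. Since \<open>E' = - E / cos\<close>,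
each integration by parts gains a factor \<open>1/m\<close> and costs a factor of order \<open>n\<close>, together with
some powers of \<open>sec\<close> and \<open>tan\<close>, which are harmless on the support of \<open>f\<close>. The functions
\<open>f\<^bsup>(j)\<^esup> sec\<^sup>p tan\<^sup>q\<close> form a family that is closed under this process, up to
linear combinations (\<open>integration_by_parts\<close>). After \<open>k\<close> steps the loss is a factor of order
\<open>\<bar>n\<bar>\<^sup>k\<close>, which is absorbed in the passage from \<open>R\<^sub>\<alpha>\<close> to any larger base, in particular to
\<open>R\<^bsub>\<alpha>+\<epsilon>\<^esub>\<close>. The induction in \<open>rapid_decay\<close> spends a part of the gap between the two bases in
each step, so that no powers of \<open>n\<close> have to be carried along.

Each \<open>e\<^sub>t\<close> with \<open>cos t \<noteq> 0\<close> is discrete entire, by the identity \<open>E(t) (\<i> + w) = 1 + \<i> w\<close> with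
\<open>w = e\<^bsup>\<i>t\<^esup>\<close>. This linear relation is inherited by the integral, because \<open>f\<close> vanishes
where \<open>cos\<close> does.\<close>

section \<open>The discrete exponential\<close>

text \<open>The equation also holds where \<open>cos t = 0\<close>: both sides are then \<open>0\<close>, for \<open>sin t = -1\<close> by the
convention \<open>x / 0 = 0\<close>. Elsewhere it follows on multiplying by \<open>\<i> + e\<^bsup>\<i>t\<^esup>\<close>.\<close>

lemma multiplier_eq:
  "(1 + \<i> * exp (\<i> * of_real t)) / (\<i> + exp (\<i> * of_real t)) =
     complex_of_real (cos t / (1 + sin t))"
proof (cases "1 + sin t = 0")
  case True
  then have s: "sin t = -1" by simp
  then have c: "cos t = 0" using sin_cos_squared_add[of t] by simp
  have "exp (\<i> * of_real t) = - \<i>"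
    using s c by (simp add: cis_conv_exp[symmetric] complex_eq_iff)
  then show ?thesis using c by simp
next
  case False
  define w where "w = exp (\<i> * complex_of_real t)"
  have w: "w = Complex (cos t) (sin t)"
    by (simp add: w_def cis_conv_exp[symmetric] complex_eq_iff)
  have ne: "\<i> + w \<noteq> 0"
    using False by (simp add: w complex_eq_iff)
  have eq: "(1 + \<i> * w) = complex_of_real (cos t / (1 + sin t)) * (\<i> + w)"
    using False sin_cos_squared_add[of t]
    by (simp add: w complex_eq_iff field_simps power2_eq_square)
  show ?thesis
    unfolding w_def[symmetric] eq by (rule nonzero_mult_div_cancel_right[OF ne])
qed

lemma disc_exp_eq:
  "disc_exp t m n = exp (\<i> * of_real t * of_int m) *
     complex_of_real ((cos t / (1 + sin t)) powi n)"
  unfolding disc_exp_def multiplier_eq by (simp only: of_real_power_int)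

lemma norm_disc_exp: "cmod (disc_exp t m n) = \<bar>cos t / (1 + sin t)\<bar> powi n"
proof -
  have "\<i> * complex_of_real t * of_int m = \<i> * complex_of_real (t * of_int m)" by simp
  then show ?thesis
    unfolding disc_exp_eq norm_mult norm_of_real power_int_abs[symmetric]
    by (simp only: norm_exp_i_times mult_1)
qed

lemma one_plus_sin_nonzero:
  fixes t :: real
  assumes "cos t \<noteq> 0"
  shows "1 + sin t \<noteq> 0"
proof
  assume "1 + sin t = 0"
  then have "sin t = - 1" by linarith
  with sin_cos_squared_add[of t] assms show False by simp
qed

lemma abs_multiplier:
  fixes t :: real
  assumes "cos t \<noteq> 0"
  shows "\<bar>cos t / (1 + sin t)\<bar> = sqrt ((1 - sin t) / (1 + sin t))"
proof -
  have ne: "1 + sin t \<noteq> 0"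
    using assms by (rule one_plus_sin_nonzero)
  have "(cos t)\<^sup>2 = (1 - sin t) * (1 + sin t)"
    using sin_cos_squared_add[of t] by (simp add: algebra_simps power2_eq_square)
  then have "(cos t / (1 + sin t))\<^sup>2 = (1 - sin t) / (1 + sin t)"
    using ne by (simp add: power_divide power2_eq_square)
  then show ?thesis by (metis real_sqrt_abs)
qed

text \<open>The defect in the discrete Cauchy-Riemann equation is
\<open>w\<^sup>m E\<^sup>n (E (\<i> + w) - (1 + \<i> w))\<close>, and the last factor vanishes by the definition of
the multiplier \<open>E\<close>. The assumption keeps \<open>E\<close> finite and nonzero, as the powers with negative
exponents require.\<close>

lemma discrete_entire_disc_exp:
  assumes "cos t \<noteq> 0"
  shows "discrete_entire (disc_exp t)"
proof -
  define w where "w = exp (\<i> * complex_of_real t)"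
  define E where "E = (1 + \<i> * w) / (\<i> + w)"
  have "E = complex_of_real (cos t / (1 + sin t))"
    unfolding E_def w_def by (rule multiplier_eq)
  then have E0: "E \<noteq> 0"
    using assms one_plus_sin_nonzero[OF assms]
    by (simp only: of_real_eq_0_iff divide_eq_0_iff) simp
  then have "\<i> + w \<noteq> 0" by (auto simp: E_def)
  then have key: "E * (\<i> + w) = 1 + \<i> * w" by (simp add: E_def)
  have d: "disc_exp t m n = exp (\<i> * of_real t * of_int m) * E powi n" for m n
    by (simp add: disc_exp_def E_def w_def)
  have e1: "exp (\<i> * of_real t * of_int (m + 1)) = exp (\<i> * of_real t * of_int m) * w" for m
    by (simp add: w_def exp_add[symmetric] algebra_simps)
  have e2: "E powi (n + 1) = E powi n * E" for n
    using E0 by (simp add: power_int_add)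
  have "disc_exp t (m + 1) (n + 1) - disc_exp t m n
      + \<i> * (disc_exp t m (n + 1) - disc_exp t (m + 1) n)
      = exp (\<i> * of_real t * of_int m) * E powi n * (E * (\<i> + w) - (1 + \<i> * w))" for m n
    unfolding d e1 e2 by (simp add: algebra_simps)
  then show ?thesis
    unfolding key discrete_entire_def by (simp add: add_eq_0_iff)
qed

section \<open>Growth in the second variable\<close>

text \<open>For \<open>0 \<le> \<beta> < \<pi>/2\<close> the sign makes the value at least \<open>1\<close>: this is the largest absolute value
over \<open>D\<^sub>\<beta>\<close> of the multiplier and of its inverse.\<close>

definition growth :: "real \<Rightarrow> real" where
  "growth \<beta> = cmod (disc_exp (- \<beta>) 0 1)"

lemma growth_eq:
  assumes "0 \<le> \<beta>" "\<beta> < pi / 2"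
  shows "growth \<beta> = sqrt ((1 + sin \<beta>) / (1 - sin \<beta>))"
proof -
  have "cos (-\<beta>) \<noteq> 0" using cos_gt_zero_pi[of "\<beta>"] assms by simp
  from abs_multiplier[OF this] show ?thesis
    by (simp add: growth_def norm_disc_exp)
qed

lemma sin_acute_less_1:
  assumes "0 \<le> \<beta>" "\<beta> < pi / 2"
  shows "sin \<beta> < (1::real)" "0 \<le> sin \<beta>"
  using assms sin_monotone_2pi[of \<beta> "pi/2"] by (auto intro!: sin_ge_zero)

lemma growth_ge_1:
  assumes "0 \<le> \<beta>" "\<beta> < pi / 2"
  shows "1 \<le> growth \<beta>"
  using sin_acute_less_1[OF assms] by (simp add: growth_eq[OF assms])

lemma growth_strict_mono:
  assumes "0 \<le> \<beta>" "\<beta> < \<gamma>" "\<gamma> < pi / 2"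
  shows "growth \<beta> < growth \<gamma>"
proof -
  have "sin \<beta> < sin \<gamma>" using assms by (intro sin_monotone_2pi) auto
  moreover have "sin \<gamma> < 1" "0 \<le> sin \<beta>" using sin_acute_less_1 assms by auto
  ultimately have "(1 + sin \<beta>) / (1 - sin \<beta>) < (1 + sin \<gamma>) / (1 - sin \<gamma>)"
    by (intro frac_less) auto
  then show ?thesis using assms by (simp add: growth_eq)
qed

text \<open>The multiplier at \<open>t\<close> has absolute value \<open>\<surd>((1 - x) / (1 + x))\<close> with \<open>x = sin t\<close>. Changing the
sign of \<open>x\<close> inverts it, so the condition on \<open>\<bar>sin t\<bar>\<close> controls positive and negative \<open>n\<close>
alike.\<close>

lemma norm_disc_exp_le:
  assumes "0 \<le> \<alpha>" "\<alpha> < pi / 2" "\<bar>sin t\<bar> \<le> sin \<alpha>"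
  shows "cmod (disc_exp t m n) \<le> growth \<alpha> ^ nat \<bar>n\<bar>"
proof -
  define E where "E = cos t / (1 + sin t)"
  have s1: "sin \<alpha> < 1" using sin_acute_less_1 assms by auto
  then have st: "\<bar>sin t\<bar> < 1" using assms by linarith
  have c: "cos t \<noteq> 0"
  proof
    assume "cos t = 0"
    then have "(sin t)\<^sup>2 = 1" using sin_cos_squared_add[of t] by simp
    then have "\<bar>sin t\<bar> = 1" by (auto simp: power2_eq_1_iff)
    with st show False by simp
  qed
  have absE: "\<bar>E\<bar> = sqrt ((1 - sin t) / (1 + sin t))"
    unfolding E_def by (rule abs_multiplier[OF c])
  have le1: "\<bar>E\<bar> \<le> growth \<alpha>"
    unfolding absE growth_eq[OF assms(1,2)] real_sqrt_le_iff
    using assms s1 by (intro frac_le) auto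
  have le2: "inverse \<bar>E\<bar> \<le> growth \<alpha>"
    unfolding absE growth_eq[OF assms(1,2)] real_sqrt_inverse[symmetric] real_sqrt_le_iff inverse_divide
    using assms s1 by (intro frac_le) auto
  have "cmod (disc_exp t m n) = \<bar>E\<bar> powi n"
    by (simp add: norm_disc_exp E_def)
  also have "\<dots> \<le> growth \<alpha> ^ nat \<bar>n\<bar>"
  proof (cases "n \<ge> 0")
    case True
    then show ?thesis using le1 by (simp add: power_int_def power_mono)
  next
    case False
    then have "\<bar>E\<bar> powi n = inverse \<bar>E\<bar> ^ nat \<bar>n\<bar>"
      by (simp add: power_int_def)
    then show ?thesis using le2 by (simp add: power_mono)
  qed
  finally show ?thesis .
qed

text \<open>The two parts of \<open>D\<^sub>\<alpha>\<close> are exchanged by \<open>t \<mapsto> \<pi> - t\<close>, which preserves \<open>sin\<close>. In terms of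
\<open>sin\<close> the support condition becomes an inequality whose negation defines an open set.\<close>

lemma mem_torus_preimage_D_set:
  assumes "0 < \<alpha>" "\<alpha> < pi / 2" "t \<in> torus_preimage (D_set \<alpha>)"
  shows "\<bar>sin t\<bar> \<le> sin \<alpha>"
proof -
  obtain s j where s: "s \<in> D_set \<alpha>" "t = s + 2 * pi * real_of_int j"
    using assms(3) by (auto simp: torus_preimage_def)
  have *: "\<bar>sin u\<bar> \<le> sin \<alpha>" if "\<bar>u\<bar> \<le> \<alpha>" for u
  proof -
    have "sin u \<le> sin \<alpha>" "sin (-u) \<le> sin \<alpha>"
      by (rule sin_monotone_2pi_le; use that assms in linarith)+
    then show ?thesis by simp
  qed
  have "\<bar>sin s\<bar> = \<bar>sin \<bar>s\<bar>\<bar>" by (simp add: abs_if)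
  also have "\<dots> \<le> sin \<alpha>"
    using s(1) *[of "\<bar>s\<bar>"] *[of "pi - \<bar>s\<bar>"] by (auto simp: D_set_def)
  finally have "\<bar>sin s\<bar> \<le> sin \<alpha>" .
  moreover have "sin t = sin s"
    using sin.plus_of_int[of s j] by (simp add: s(2) mult.commute mult.left_commute)
  ultimately show ?thesis by simp
qed

section \<open>Iterated derivatives of smooth functions on the line\<close>

definition vderiv :: "nat \<Rightarrow> (real \<Rightarrow> complex) \<Rightarrow> real \<Rightarrow> complex" where
  "vderiv k f = ((\<lambda>g s. vector_derivative g (at s)) ^^ k) f"

lemma vderiv_0 [simp]: "vderiv 0 f = f"
  by (simp add: vderiv_def)

lemma vderiv_Suc: "vderiv (Suc k) f t = vector_derivative (vderiv k f) (at t)"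
  by (simp add: vderiv_def)

lemma vderiv_has_vector_derivative:
  assumes "smooth f"
  shows "(vderiv k f has_vector_derivative vderiv (Suc k) f t) (at t)"
  using assms unfolding smooth_def vderiv_Suc vector_derivative_works[symmetric]
  by (simp add: vderiv_def)

lemma vderiv_periodic:
  assumes "smooth_torus f"
  shows "vderiv k f (t + 2 * pi) = vderiv k f t"
proof (induction k arbitrary: t)
  case 0
  then show ?case using assms by (simp add: smooth_torus_def)
next
  case (Suc k)
  have sm: "smooth f" using assms by (simp add: smooth_torus_def)
  have "((\<lambda>s. vderiv k f (s + 2 * pi)) has_vector_derivative
          vderiv (Suc k) f (t + 2 * pi)) (at t)"
  proof -
    have "((\<lambda>s. s + 2 * pi) has_vector_derivative 1) (at t)"
      by (auto simp flip: has_real_derivative_iff_has_vector_derivative intro!: derivative_eq_intros)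
    from vector_diff_chain_at[OF this vderiv_has_vector_derivative[OF sm, of k]]
    show ?thesis by (simp add: o_def)
  qed
  then have "(vderiv k f has_vector_derivative vderiv (Suc k) f (t + 2 * pi)) (at t)"
    by (simp add: Suc)
  with vderiv_has_vector_derivative[OF sm] show ?case
    using vector_derivative_unique_at by blast
qed

lemma vderiv_eq_0_on_open:
  assumes "open U" "\<And>t. t \<in> U \<Longrightarrow> f t = 0" "smooth f" "t \<in> U"
  shows "vderiv k f t = 0"
  using assms(4)
proof (induction k arbitrary: t)
  case 0
  then show ?case using assms by simp
next
  case (Suc k)
  have "(vderiv k f has_vector_derivative 0) (at t)"
    by (rule has_vector_derivative_transform_within_open[where f = "\<lambda>_. 0" and S = U])
       (use Suc assms in auto)
  with vderiv_has_vector_derivative[OF assms(3)] show ?case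
    using vector_derivative_unique_at by blast
qed

section \<open>Derivatives of the weighted exponentials\<close>

text \<open>The weights \<open>sec\<^sup>p tan\<^sup>q\<close> are what repeated differentiation of powers of the multiplier
produces. They span a space that is closed under differentiation and under multiplication by
\<open>sec\<close>.\<close>

definition weight :: "nat \<Rightarrow> nat \<Rightarrow> int \<Rightarrow> int \<Rightarrow> real \<Rightarrow> complex" where
  "weight p q m n t = of_real ((1 / cos t) ^ p * tan t ^ q) * disc_exp t m n"

text \<open>The terms come from \<open>e\<^bsup>\<i>tm\<^esup>\<close>, from \<open>sec' = sec tan\<close>, from \<open>tan' = sec\<^sup>2\<close>, and from
\<open>E' = - E sec\<close>, respectively. For \<open>q = 0\<close> the truncated exponent \<open>q - 1\<close> occurs with
coefficient \<open>0\<close>.\<close>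

lemma weight_has_vector_derivative:
  assumes "cos t \<noteq> 0"
  shows "(weight p q m n has_vector_derivative
     (\<i> * of_int m * weight p q m n t + of_nat p * weight p (q + 1) m n t
       + of_nat q * weight (p + 2) (q - 1) m n t
       - of_int n * weight (p + 1) q m n t)) (at t)"
proof -
  define E :: "real \<Rightarrow> real" where "E = (\<lambda>t. cos t / (1 + sin t))"
  define e where "e = (\<lambda>t. exp (\<i> * complex_of_real t * of_int m))"
  define r where "r = (\<lambda>p q t. (1 / cos t) ^ p * tan t ^ q * E t powi n)"
  have w: "weight p q m n = (\<lambda>t. e t * complex_of_real (r p q t))" for p q
    by (simp add: fun_eq_iff weight_def disc_exp_eq E_def e_def r_def)
  have ne: "1 + sin t \<noteq> 0"
    using assms by (rule one_plus_sin_nonzero)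
  have sq: "cos t * cos t = 1 - sin t * sin t"
    using sin_cos_squared_add[of t] by (simp add: power2_eq_square)
  have Ene: "E t \<noteq> 0" using assms ne by (simp add: E_def)
  have dsec: "((\<lambda>t. 1 / cos t) has_real_derivative tan t / cos t) (at t)"
    using assms by (auto intro!: derivative_eq_intros simp: tan_def power2_eq_square)
  have dtan: "(tan has_real_derivative (1 / cos t)\<^sup>2) (at t)"
    using DERIV_tan[OF assms] by (simp add: power_divide inverse_eq_divide)
  have dE: "(E has_real_derivative - (E t / cos t)) (at t)"
  proof -
    have "(E has_real_derivative
            ((- sin t) * (1 + sin t) - cos t * cos t) / ((1 + sin t) * (1 + sin t))) (at t)"
      unfolding E_def using ne by (auto intro!: derivative_eq_intros)
    moreover have "((- sin t) * (1 + sin t) - cos t * cos t) / ((1 + sin t) * (1 + sin t)) = - (E t / cos t)"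
      using assms ne by (simp add: E_def sq divide_simps) (simp add: algebra_simps)
    ultimately show ?thesis by simp
  qed
  have dsecp: "((\<lambda>t. (1 / cos t) ^ p) has_real_derivative
         real p * (1 / cos t) ^ p * tan t) (at t)"
    using DERIV_power[OF dsec, of p] by (cases p) (auto simp: mult_ac)
  have dtanq: "((\<lambda>t. tan t ^ q) has_real_derivative
         real q * tan t ^ (q - 1) * (1 / cos t)\<^sup>2) (at t)"
    using DERIV_power[OF dtan, of q] by (simp add: mult_ac)
  have dEn: "((\<lambda>t. E t powi n) has_real_derivative - (of_int n * E t powi n * (1 / cos t))) (at t)"
  proof -
    have "((\<lambda>t. E t powi n) has_real_derivative
        (- (E t / cos t) * (of_int n * E t powi (n - 1)))) (at t)"
      using DERIV_power_int[OF dE, of n] Ene by (simp add: mult_ac)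
    moreover have "E t * E t powi (n - 1) = E t powi n"
      using Ene power_int_add[of "E t" 1 "n - 1"] by simp
    ultimately show ?thesis by (simp add: mult_ac)
  qed
  have dr: "(r p q has_real_derivative
     real p * r p (q + 1) t + real q * r (p + 2) (q - 1) t - of_int n * r (p + 1) q t) (at t)"
    unfolding r_def
    by (rule DERIV_cong[OF DERIV_mult[OF DERIV_mult[OF dsecp dtanq] dEn]])
       (simp add: algebra_simps power_add power2_eq_square)
  have dr': "((\<lambda>t. complex_of_real (r p q t)) has_vector_derivative of_real
     (real p * r p (q + 1) t + real q * r (p + 2) (q - 1) t - of_int n * r (p + 1) q t)) (at t)"
    using dr by (intro has_vector_derivative_of_real) (simp add: has_real_derivative_iff_has_vector_derivative)
  have de: "(e has_vector_derivative \<i> * of_int m * e t) (at t)"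
    unfolding e_def
    by (auto intro!: derivative_eq_intros has_vector_derivative_real_field simp: mult_ac)
  show ?thesis
    unfolding w using has_vector_derivative_mult[OF de dr'] by (simp add: algebra_simps)
qed

lemma disc_exp_periodic: "disc_exp (t + 2 * pi) m n = disc_exp t m n"
proof -
  have "exp (\<i> * of_real (t + 2 * pi) * of_int m) =
      exp (\<i> * of_real t * of_int m) * exp (2 * of_int m * of_real pi * \<i>)"
    by (simp add: exp_add[symmetric] algebra_simps)
  moreover have "exp (2 * of_int m * of_real pi * \<i>) = 1"
    using exp_integer_2pi[of "of_int m"] by (simp add: mult_ac)
  ultimately show ?thesis by (simp add: disc_exp_eq)
qed

section \<open>Integration by parts\<close>

locale torus_function =
  fixes \<alpha> :: real and f :: "real \<Rightarrow> complex"
  assumes \<alpha>: "0 < \<alpha>" "\<alpha> < pi / 2"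
    and smooth_torus: "smooth_torus f"
    and supp: "lift_supp f \<subseteq> torus_preimage (D_set \<alpha>)"
begin

text \<open>A neighbourhood of the zeros of \<open>cos\<close> lies outside the support of \<open>f\<close>. Hence \<open>f\<close> and all its
derivatives remove the singularities of \<open>sec\<close>, \<open>tan\<close> and the discrete exponential there.\<close>

lemma vderiv_vanishes:
  assumes "sin \<alpha> < \<bar>sin t\<bar>"
  shows "vderiv j f t = 0"
proof (rule vderiv_eq_0_on_open[where U = "{t. sin \<alpha> < \<bar>sin t\<bar>}"])
  show "open {t. sin \<alpha> < \<bar>sin t\<bar>}"
    by (intro open_Collect_less continuous_intros)
  show "f s = 0" if "s \<in> {t. sin \<alpha> < \<bar>sin t\<bar>}" for s
  proof (rule ccontr)
    assume "f s \<noteq> 0"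
    then have "s \<in> lift_supp f"
      using subsetD[OF closure_subset, of s "{t. f t \<noteq> 0}"] by (simp add: lift_supp_def)
    then have "\<bar>sin s\<bar> \<le> sin \<alpha>"
      by (rule mem_torus_preimage_D_set[OF \<alpha> subsetD[OF supp]])
    with that show False by simp
  qed
qed (use assms smooth_torus in \<open>auto simp: smooth_torus_def\<close>)

definition integrand :: "nat \<Rightarrow> nat \<Rightarrow> nat \<Rightarrow> int \<Rightarrow> int \<Rightarrow> real \<Rightarrow> complex" where
  "integrand j p q m n t = vderiv j f t * weight p q m n t"

lemma abs_sin_gt_if_cos_eq_0:
  assumes "cos t = 0"
  shows "sin \<alpha> < \<bar>sin t\<bar>"
proof -
  have "(sin t)\<^sup>2 = 1" using sin_cos_squared_add[of t] assms by simp
  then have "\<bar>sin t\<bar> = 1" by (auto simp: power2_eq_1_iff)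
  then show ?thesis using sin_acute_less_1[of \<alpha>] \<alpha> by simp
qed

text \<open>At the zeros of \<open>cos\<close> the product rule is not available, but the integrand is identically zero
nearby, and so is the right-hand side.\<close>

lemma integrand_has_vector_derivative:
  "(integrand j p q m n has_vector_derivative
     (\<i> * of_int m * integrand j p q m n t + integrand (Suc j) p q m n t
       + of_nat p * integrand j p (q + 1) m n t + of_nat q * integrand j (p + 2) (q - 1) m n t
       - of_int n * integrand j (p + 1) q m n t)) (at t)"
proof (cases "cos t = 0")
  case True
  have "(integrand j p q m n has_vector_derivative 0) (at t)"
  proof (rule has_vector_derivative_transform_within_open[where f = "\<lambda>_. 0"])
    show "open {t. sin \<alpha> < \<bar>sin t\<bar>}"
      by (intro open_Collect_less continuous_intros)
  qed (use abs_sin_gt_if_cos_eq_0[OF True] in \<open>auto simp: integrand_def vderiv_vanishes\<close>)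
  then show ?thesis
    using vderiv_vanishes[OF abs_sin_gt_if_cos_eq_0[OF True]] by (simp add: integrand_def)
next
  case False
  have "smooth f" using smooth_torus by (simp add: smooth_torus_def)
  from has_vector_derivative_mult[OF vderiv_has_vector_derivative[OF this]
      weight_has_vector_derivative[OF False]]
  show ?thesis unfolding integrand_def by (simp add: algebra_simps)
qed

lemma continuous_on_integrand: "continuous_on S (integrand j p q m n)"
  by (intro continuous_at_imp_continuous_on ballI
      has_vector_derivative_continuous[OF integrand_has_vector_derivative])

lemma integrand_integrable: "integrand j p q m n integrable_on {-pi..pi}"
  by (intro integrable_continuous_interval continuous_on_integrand)

definition coeff :: "nat \<Rightarrow> nat \<Rightarrow> nat \<Rightarrow> int \<Rightarrow> int \<Rightarrow> complex" where
  "coeff j p q m n = integral {-pi..pi} (integrand j p q m n)"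

lemma integrand_has_integral: "(integrand j p q m n has_integral coeff j p q m n) {-pi..pi}"
  unfolding coeff_def by (rule integrable_integral[OF integrand_integrable])

lemma exp_transform_eq_coeff: "exp_transform f m n = coeff 0 0 0 m n / (2 * of_real pi)"
  by (simp add: exp_transform_def coeff_def integrand_def[abs_def] weight_def)

text \<open>The integral of the derivative of the integrand over a full period is zero. Apart from
terms with coefficients independent of \<open>m\<close> and \<open>n\<close>, multiplication by \<open>m\<close> is thus traded for
multiplication by \<open>n\<close> within the family.\<close>

lemma integration_by_parts:
  "\<i> * of_int m * coeff j p q m n =
     of_int n * coeff j (p + 1) q m n - coeff (Suc j) p q m n
       - of_nat p * coeff j p (q + 1) m n - of_nat q * coeff j (p + 2) (q - 1) m n"
proof -
  let ?D = "\<lambda>t. \<i> * of_int m * integrand j p q m n t + integrand (Suc j) p q m n t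
       + of_nat p * integrand j p (q + 1) m n t + of_nat q * integrand j (p + 2) (q - 1) m n t
       - of_int n * integrand j (p + 1) q m n t"
  have "(?D has_integral integrand j p q m n pi - integrand j p q m n (-pi)) {-pi..pi}"
    by (rule fundamental_theorem_of_calculus)
       (simp, rule has_vector_derivative_at_within[OF integrand_has_vector_derivative])
  moreover have "integrand j p q m n pi - integrand j p q m n (-pi) = 0"
    using vderiv_periodic[OF smooth_torus, of j "-pi"] disc_exp_periodic[of "-pi" m n]
    by (simp add: integrand_def weight_def)
  ultimately have "(?D has_integral 0) {-pi..pi}" by simp
  moreover have "(?D has_integral
        \<i> * of_int m * coeff j p q m n + coeff (Suc j) p q m n
       + of_nat p * coeff j p (q + 1) m n + of_nat q * coeff j (p + 2) (q - 1) m n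
       - of_int n * coeff j (p + 1) q m n) {-pi..pi}"
    by (intro has_integral_add has_integral_diff has_integral_mult_right integrand_has_integral)
  ultimately have "0 = \<i> * of_int m * coeff j p q m n + coeff (Suc j) p q m n
       + of_nat p * coeff j p (q + 1) m n + of_nat q * coeff j (p + 2) (q - 1) m n
       - of_int n * coeff j (p + 1) q m n"
    by (rule has_integral_unique)
  then show ?thesis by algebra
qed

section \<open>Decay of the transform\<close>

text \<open>The part of the integrand that does not depend on \<open>m\<close> and \<open>n\<close> is continuous, hence bounded on
a period. It is supported where the discrete exponential satisfies its growth bound.\<close>

lemma norm_coeff_le:
  "\<exists>c\<ge>0. \<forall>m n. cmod (coeff j p q m n) \<le> c * growth \<alpha> ^ nat \<bar>n\<bar>"
proof -
  have "bounded (integrand j p q 0 0 ` {-pi..pi})"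
    by (intro compact_imp_bounded compact_continuous_image continuous_on_integrand) auto
  then obtain B where B: "\<And>t. t \<in> {-pi..pi} \<Longrightarrow> cmod (integrand j p q 0 0 t) \<le> B" "B > 0"
    unfolding bounded_pos by (metis imageI)
  have pt: "cmod (integrand j p q m n t) \<le> B * growth \<alpha> ^ nat \<bar>n\<bar>" if "t \<in> {-pi..pi}" for m n t
  proof (cases "\<bar>sin t\<bar> \<le> sin \<alpha>")
    case True
    have "integrand j p q m n t = integrand j p q 0 0 t * disc_exp t m n"
      by (simp add: integrand_def weight_def disc_exp_eq[of t 0 0])
    then show ?thesis
      using B that norm_disc_exp_le[OF _ \<alpha>(2) True, of m n] \<alpha>
      by (auto simp: norm_mult intro!: mult_mono)
  next
    case False
    then have "integrand j p q m n t = 0" by (simp add: integrand_def vderiv_vanishes)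
    then show ?thesis using B growth_ge_1[of \<alpha>] \<alpha> by simp
  qed
  have "cmod (coeff j p q m n) \<le> (B * growth \<alpha> ^ nat \<bar>n\<bar>) * (pi - (-pi))" for m n
    unfolding coeff_def by (rule integral_bound[OF _ continuous_on_integrand pt]) simp_all
  then have "cmod (coeff j p q m n) \<le> (2 * pi * B) * growth \<alpha> ^ nat \<bar>n\<bar>" for m n
    by (simp add: algebra_simps)
  with B(2) show ?thesis by (intro exI[of _ "2 * pi * B"] conjI allI) simp_all
qed

text \<open>Induction on \<open>k\<close> by means of integration by parts. The factor \<open>\<bar>n\<bar>\<close> that appears is absorbed by
applying the induction hypothesis with an intermediate base \<open>r < R\<close> to the term concerned; this
is why the base varies in the induction.\<close>

lemma rapid_decay:
  assumes "growth \<alpha> < R"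
  shows "\<exists>c\<ge>0. \<forall>m n. (1 + \<bar>real_of_int m\<bar>) ^ k * cmod (coeff j p q m n) \<le> c * R ^ nat \<bar>n\<bar>"
  using assms
proof (induction k arbitrary: R j p q)
  case 0
  obtain c where c: "c \<ge> 0" "\<And>m n. cmod (coeff j p q m n) \<le> c * growth \<alpha> ^ nat \<bar>n\<bar>"
    using norm_coeff_le[of j p q] by blast
  have "c * growth \<alpha> ^ nat \<bar>n\<bar> \<le> c * R ^ nat \<bar>n\<bar>" for n
    using c 0 growth_ge_1[of \<alpha>] \<alpha> by (intro mult_left_mono power_mono) auto
  then have "\<forall>m n. cmod (coeff j p q m n) \<le> c * R ^ nat \<bar>n\<bar>"
    by (blast intro: order_trans[OF c(2)])
  then show ?case using c(1) by auto
next
  case (Suc k)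
  obtain r where r: "growth \<alpha> < r" "r < R" using Suc.prems dense by blast
  have r1: "r > 0" using r growth_ge_1[of \<alpha>] \<alpha> by simp
  obtain c1 where c1: "c1 \<ge> 0"
    "\<And>m n. (1 + \<bar>real_of_int m\<bar>) ^ k * cmod (coeff j p q m n) \<le> c1 * R ^ nat \<bar>n\<bar>"
    using Suc.IH[OF Suc.prems, of j p q] by blast
  obtain c2 where c2: "c2 \<ge> 0"
    "\<And>m n. (1 + \<bar>real_of_int m\<bar>) ^ k * cmod (coeff (Suc j) p q m n) \<le> c2 * R ^ nat \<bar>n\<bar>"
    using Suc.IH[OF Suc.prems, of "Suc j" p q] by blast
  obtain c3 where c3: "c3 \<ge> 0"
    "\<And>m n. (1 + \<bar>real_of_int m\<bar>) ^ k * cmod (coeff j p (q + 1) m n) \<le> c3 * R ^ nat \<bar>n\<bar>"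
    using Suc.IH[OF Suc.prems, of j p "q + 1"] by blast
  obtain c4 where c4: "c4 \<ge> 0"
    "\<And>m n. (1 + \<bar>real_of_int m\<bar>) ^ k * cmod (coeff j (p + 2) (q - 1) m n) \<le> c4 * R ^ nat \<bar>n\<bar>"
    using Suc.IH[OF Suc.prems, of j "p + 2" "q - 1"] by blast
  obtain c5 where c5: "c5 \<ge> 0"
    "\<And>m n. (1 + \<bar>real_of_int m\<bar>) ^ k * cmod (coeff j (p + 1) q m n) \<le> c5 * r ^ nat \<bar>n\<bar>"
    using Suc.IH[OF r(1), of j "p + 1" q] by blast
  define \<delta> where "\<delta> = R / r - 1"
  have \<delta>: "\<delta> > 0" using r r1 by (simp add: \<delta>_def)
  (* Bernoulli's inequality for (R / r)^N shows that the linear factor N fits in the gap. *)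
  have gain: "real N * r ^ N \<le> (1 / \<delta>) * R ^ N" for N
  proof -
    have "real N * \<delta> \<le> (1 + \<delta>) ^ N"
      using Bernoulli_inequality[of \<delta> N] \<delta> by simp
    then have "real N * \<delta> * r ^ N \<le> (1 + \<delta>) ^ N * r ^ N"
      using r1 by (intro mult_right_mono) auto
    also have "\<dots> = R ^ N"
      using r1 by (simp add: \<delta>_def power_divide)
    finally show ?thesis using \<delta> by (simp add: field_simps)
  qed
  have "(1 + \<bar>real_of_int m\<bar>) ^ Suc k * cmod (coeff j p q m n)
      \<le> (c1 + c2 + p * c3 + q * c4 + c5 / \<delta>) * R ^ nat \<bar>n\<bar>" for m n
  proof -
    let ?M = "(1 + \<bar>real_of_int m\<bar>) ^ k"
    have "\<bar>real_of_int m\<bar> * cmod (coeff j p q m n) = cmod (\<i> * of_int m * coeff j p q m n)"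
      by (simp add: norm_mult)
    also have "\<dots> \<le> \<bar>real_of_int n\<bar> * cmod (coeff j (p + 1) q m n) + cmod (coeff (Suc j) p q m n)
       + p * cmod (coeff j p (q + 1) m n) + q * cmod (coeff j (p + 2) (q - 1) m n)"
      unfolding integration_by_parts
      by (intro order_trans[OF norm_triangle_ineq4] add_mono) (simp_all add: norm_mult)
    finally have "?M * (\<bar>real_of_int m\<bar> * cmod (coeff j p q m n)) \<le>
        ?M * (\<bar>real_of_int n\<bar> * cmod (coeff j (p + 1) q m n) + cmod (coeff (Suc j) p q m n)
       + p * cmod (coeff j p (q + 1) m n) + q * cmod (coeff j (p + 2) (q - 1) m n))"
      by (intro mult_left_mono) auto
    then have "(1 + \<bar>real_of_int m\<bar>) ^ Suc k * cmod (coeff j p q m n) \<le>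
        ?M * cmod (coeff j p q m n) + \<bar>real_of_int n\<bar> * (?M * cmod (coeff j (p + 1) q m n))
        + ?M * cmod (coeff (Suc j) p q m n) + p * (?M * cmod (coeff j p (q + 1) m n))
        + q * (?M * cmod (coeff j (p + 2) (q - 1) m n))"
      by (simp add: algebra_simps)
    also have "\<dots> \<le> c1 * R ^ nat \<bar>n\<bar> + c5 * ((1 / \<delta>) * R ^ nat \<bar>n\<bar>)
        + c2 * R ^ nat \<bar>n\<bar> + p * (c3 * R ^ nat \<bar>n\<bar>) + q * (c4 * R ^ nat \<bar>n\<bar>)"
    proof (intro add_mono c1 c2 mult_left_mono c3 c4)
      have "\<bar>real_of_int n\<bar> * (?M * cmod (coeff j (p + 1) q m n))
          \<le> \<bar>real_of_int n\<bar> * (c5 * r ^ nat \<bar>n\<bar>)"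
        by (intro mult_left_mono c5) auto
      also have "\<dots> = c5 * (real (nat \<bar>n\<bar>) * r ^ nat \<bar>n\<bar>)" by simp
      also have "\<dots> \<le> c5 * ((1 / \<delta>) * R ^ nat \<bar>n\<bar>)"
        by (intro mult_left_mono gain c5)
      finally show "\<bar>real_of_int n\<bar> * (?M * cmod (coeff j (p + 1) q m n))
          \<le> c5 * ((1 / \<delta>) * R ^ nat \<bar>n\<bar>)" .
    qed auto
    finally show ?thesis by (simp add: algebra_simps)
  qed
  moreover have "0 \<le> c1 + c2 + p * c3 + q * c4 + c5 / \<delta>"
    using c1 c2 c3 c4 c5 \<delta> by simp
  ultimately show ?case by blast
qed

lemma discrete_entire_exp_transform: "discrete_entire (exp_transform f)"
  unfolding discrete_entire_def
proof (intro allI)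
  fix m n :: int
  let ?g = "\<lambda>m n. integrand 0 0 0 m n"
  have eq: "?g (m + 1) (n + 1) t - ?g m n t = - \<i> * (?g m (n + 1) t - ?g (m + 1) n t)" for t
  proof (cases "cos t = 0")
    case True
    then show ?thesis
      using vderiv_vanishes[OF abs_sin_gt_if_cos_eq_0[OF True], of 0] by (simp add: integrand_def)
  next
    case False
    have "f t * (disc_exp t (m + 1) (n + 1) - disc_exp t m n)
        = f t * (- \<i> * (disc_exp t m (n + 1) - disc_exp t (m + 1) n))"
      using discrete_entire_disc_exp[OF False] by (simp add: discrete_entire_def)
    then show ?thesis by (simp add: integrand_def weight_def algebra_simps)
  qed
  have "((\<lambda>t. ?g (m + 1) (n + 1) t - ?g m n t) has_integral
      (coeff 0 0 0 (m + 1) (n + 1) - coeff 0 0 0 m n)) {-pi..pi}"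
    by (intro has_integral_diff integrand_has_integral)
  moreover have "((\<lambda>t. ?g (m + 1) (n + 1) t - ?g m n t) has_integral
      (- \<i> * (coeff 0 0 0 m (n + 1) - coeff 0 0 0 (m + 1) n))) {-pi..pi}"
    unfolding eq by (intro has_integral_diff has_integral_mult_right integrand_has_integral)
  ultimately have "coeff 0 0 0 (m + 1) (n + 1) - coeff 0 0 0 m n =
      - \<i> * (coeff 0 0 0 m (n + 1) - coeff 0 0 0 (m + 1) n)"
    by (rule has_integral_unique)
  then show "exp_transform f (m + 1) (n + 1) - exp_transform f m n =
      - \<i> * (exp_transform f m (n + 1) - exp_transform f (m + 1) n)"
    unfolding exp_transform_eq_coeff diff_divide_distrib[symmetric] by simp
qed

end

theorem theorem1p3:
  fixes \<alpha> :: real and f :: "real \<Rightarrow> complex"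
  assumes "0 < \<alpha>" and "\<alpha> < pi / 2"
    and "smooth_torus f"
    and "lift_supp f \<subseteq> torus_preimage (D_set \<alpha>)"
  shows "discrete_entire (exp_transform f) \<and>
    (\<forall>(k::nat) (\<epsilon>::real). \<epsilon> > 0 \<longrightarrow> \<alpha> + \<epsilon> < pi / 2 \<longrightarrow>
      (\<exists>c>0. \<forall>m n.
        cmod (exp_transform f m n) \<le>
          c * (1 + \<bar>real_of_int m\<bar>) powi (- int k) *
          cmod (disc_exp (- (\<alpha> + \<epsilon>)) 0 1) ^ nat \<bar>n\<bar>))"
proof -
  interpret torus_function \<alpha> f by unfold_locales fact+
  have "\<exists>c>0. \<forall>m n. cmod (exp_transform f m n) \<le>
          c * (1 + \<bar>real_of_int m\<bar>) powi (- int k) * growth (\<alpha> + \<epsilon>) ^ nat \<bar>n\<bar>"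
    if "\<epsilon> > 0" "\<alpha> + \<epsilon> < pi / 2" for k \<epsilon>
  proof -
    have "growth \<alpha> < growth (\<alpha> + \<epsilon>)" using that \<alpha> by (intro growth_strict_mono) auto
    from rapid_decay[OF this, of k 0 0 0] obtain c where c: "c \<ge> 0"
      "\<And>m n. (1 + \<bar>real_of_int m\<bar>) ^ k * cmod (coeff 0 0 0 m n) \<le> c * growth (\<alpha> + \<epsilon>) ^ nat \<bar>n\<bar>"
      by blast
    have "cmod (exp_transform f m n) \<le>
          (c + 1) * (1 + \<bar>real_of_int m\<bar>) powi (- int k) * growth (\<alpha> + \<epsilon>) ^ nat \<bar>n\<bar>" for m n
    proof -
      have M: "(1 + \<bar>real_of_int m\<bar>) ^ k > 0" by simp
      have "cmod (exp_transform f m n) = cmod (coeff 0 0 0 m n) / (2 * pi)"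
        by (simp add: exp_transform_eq_coeff norm_divide norm_mult)
      also have "\<dots> \<le> cmod (coeff 0 0 0 m n)"
        using pi_ge_two mult_left_mono[of 1 "2 * pi" "cmod (coeff 0 0 0 m n)"]
        by (simp add: divide_le_eq)
      also have "\<dots> \<le> c * growth (\<alpha> + \<epsilon>) ^ nat \<bar>n\<bar> / (1 + \<bar>real_of_int m\<bar>) ^ k"
        using c(2)[of m n] M by (simp add: pos_le_divide_eq mult.commute)
      also have "\<dots> \<le> (c + 1) * growth (\<alpha> + \<epsilon>) ^ nat \<bar>n\<bar> / (1 + \<bar>real_of_int m\<bar>) ^ k"
        using growth_ge_1[of "\<alpha> + \<epsilon>"] that \<alpha> by (intro divide_right_mono mult_right_mono) auto
      finally show ?thesis by (simp add: power_int_minus divide_inverse mult_ac)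
    qed
    \<comment> \<open>The summand \<open>1\<close> makes the constant positive also when \<open>c = 0\<close>.\<close>
    then show ?thesis using c(1) by (intro exI[of _ "c + 1"]) auto
  qed
  then show ?thesis
    using discrete_entire_exp_transform unfolding growth_def by blast
qed

end
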